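(* Let $P = \{ p_{1}, \ldots, p_{d} \}$ and $Q = \{ q_{1}, \ldots, q_{d} \}$ be finite partially ordered sets with $|P| = |Q| = d$, and let $\Delta(P,-Q) \subset \mathbb{R}^{d}$ be their twinned order polytope. Then the following conditions are equivalent: (i) the origin of $\mathbb{R}^{d}$ belongs to the interior of $\Delta(P,-Q)$; (ii) $P$ and $Q$ possess a common linear extension, i.e. there is a permutation of $[d]=\{1,\ldots,d\}$ which is a linear extension of both $P$ and $Q$.
   Context: A subset $I$ of a finite poset $P$ is a poset ideal of $P$ if $p_i \in I$ and $p_j \in P$ with $p_j \le p_i$ imply $p_j \in I$; in particular $\emptyset$ and $P$ are poset ideals. Let $\mathcal{J}(P)$ and $\mathcal{J}(Q)$ denote the sets of poset ideals of $P$ and $Q$. A linear extension of $P = \{p_1,\ldots,p_d\}$ is a permutation $\sigma = i_1 i_2 \cdots i_d$ of $[d]$ such that $a < b$ whenever $p_{i_a} < p_{i_b}$ in $P$; likewise for $Q = \{q_1,\ldots,q_d\}$ (with $q$ in place of $p$). The labelings of $P$ and $Q$ by $1,\ldots,d$ are fixed. Let $\mathbf{e}_1,\ldots,\mathbf{e}_d$ be the canonical unit coordinate vectors of $\mathbb{R}^d$. For $I \subset P$ put $\rho(I) = \sum_{p_i \in I} \mathbf{e}_i$, and for $J \subset Q$ put $\rho(J) = \sum_{q_j \in J} \mathbf{e}_j$. Define $$\Omega(P,-Q) = \{ \rho(I) : \emptyset \ne I \in \mathcal{J}(P) \} \cup \{ -\rho(J) : \emptyset \neq J \in \mathcal{J}(Q)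 \} \cup \{ \mathbf{0} \} \subset \mathbb{Z}^d.$$ The twinned order polytope $\Delta(P,-Q) \subset \mathbb{R}^d$ is the convex hull of $\Omega(P,-Q)$. *)

theory Defs
  imports "HOL-Analysis.Analysis" "HOL-Combinatorics.Multiset_Permutations"
begin

(* The finite type 'n plays the role of the label set [d] (d = CARD('n)), so that real ^ 'n
   is R^d and axis i 1 is e_i.  A poset is a carrier with a non-strict order relation;
   (x, y) : r means x <= y.  Its elements are labelled by a bijection p from 'n onto the carrier,
   p i being p_i. *)

definition poset_ideals :: "'a set \<Rightarrow> 'a rel \<Rightarrow> 'a set set" where
  "poset_ideals P r = {I. I \<subseteq> P \<and> (\<forall>x\<in>I. \<forall>y\<in>P. (y, x) \<in> r \<longrightarrow> y \<in> I)}"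

(* A permutation i_1 i_2 ... i_d of the labels is the word [i_1, ..., i_d] in which each label
   occurs exactly once; list positions count from 0, which does not affect their comparison. *)

definition is_linear_extension :: "'a rel \<Rightarrow> ('n::finite \<Rightarrow> 'a) \<Rightarrow> 'n list \<Rightarrow> bool" where
  "is_linear_extension r p \<sigma> \<longleftrightarrow>
     \<sigma> \<in> permutations_of_set UNIV \<and>
     (\<forall>a < length \<sigma>. \<forall>b < length \<sigma>.
        (p (\<sigma> ! a), p (\<sigma> ! b)) \<in> r \<and> p (\<sigma> ! a) \<noteq> p (\<sigma> ! b) \<longrightarrow> a < b)"

definition rho :: "('n::finite \<Rightarrow> 'a) \<Rightarrow> 'a set \<Rightarrow> real ^ 'n" where
  "rho p I = (\<Sum>i | p i \<in> I. axis i 1)"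

definition twinned_Omega ::
  "'a set \<Rightarrow> 'a rel \<Rightarrow> ('n::finite \<Rightarrow> 'a) \<Rightarrow> 'b set \<Rightarrow> 'b rel \<Rightarrow> ('n \<Rightarrow> 'b) \<Rightarrow> (real ^ 'n) set"
where
  "twinned_Omega P r p Q s q =
     {rho p I | I. I \<noteq> {} \<and> I \<in> poset_ideals P r} \<union>
     {- rho q J | J. J \<noteq> {} \<and> J \<in> poset_ideals Q s} \<union> {0}"

definition twinned_order_polytope ::
  "'a set \<Rightarrow> 'a rel \<Rightarrow> ('n::finite \<Rightarrow> 'a) \<Rightarrow> 'b set \<Rightarrow> 'b rel \<Rightarrow> ('n \<Rightarrow> 'b) \<Rightarrow> (real ^ 'n) set"
where
  "twinned_order_polytope P r p Q s q = convex hull (twinned_Omega P r p Q s q)"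

end

theory Submission
  imports Defs
begin

text \<open>
  Transport both orders to the label set along the labellings; a common linear extension is an
  enumeration of the labels that respects both strict orders at once.

  If such an enumeration exists, each of its initial segments is a poset ideal of both posets.
  Hence the hull contains the indicator vectors of these segments and their negatives, and half the
  difference of two consecutive ones is, up to sign, half a unit vector. So the hull contains a
  multiple of the cross-polytope around the origin (\<open>zero_in_interior_if_half_axes\<close>).

  Conversely, a common linear extension is built greedily, by repeatedly removing a label that is
  minimal in both orders (\<open>enumeration_if_minimal_elements\<close>). This can only get stuck at a nonempty
  set \<open>S\<close> of labels in which no label is minimal for both. Then the \<open>P\<close>-minimal and the \<open>Q\<close>-minimal
  labels of \<open>S\<close> are disjoint, each of the latter has one of the former \<open>P\<close>-below it, and each of the
  former has one of the latter \<open>Q\<close>-below it. Following these choices around a cycle yields disjoint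
  sets \<open>C\<close> and \<open>D\<close> with bijections between them that descend in \<open>P\<close> from \<open>D\<close> to \<open>C\<close> and in \<open>Q\<close> from
  \<open>C\<close> to \<open>D\<close> (\<open>alternating_descent_if_no_common_minimal\<close>). An ideal of \<open>P\<close> therefore meets \<open>C\<close> in at
  least as many labels as \<open>D\<close>, and an ideal of \<open>Q\<close> meets \<open>D\<close> in at least as many as \<open>C\<close>. So the
  functional counting labels in \<open>C\<close> minus labels in \<open>D\<close> is nonnegative on the whole polytope. It is
  not zero, because \<open>C\<close> and \<open>D\<close> are disjoint; hence the origin is not an interior point.
\<close>

section \<open>Strict orders on finite sets\<close>

lemma minimal_below:
  assumes "finite S" "trans r" "irrefl r" "b \<in> S"
  shows "\<exists>a\<in>S. (a = b \<or> (a, b) \<in> r) \<and> (\<forall>c\<in>S. (c, a) \<notin> r)"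
proof -
  let ?r = "r \<inter> S \<times> S"
  have "acyclic r"
    using assms(2,3) by (simp add: acyclic_irrefl trancl_id)
  then have "acyclic ?r" by (rule acyclic_subset) blast
  then have "wf ?r" using assms(1) by (intro finite_acyclic_wf) auto
  moreover have "b \<in> {a\<in>S. a = b \<or> (a, b) \<in> r}" using assms(4) by simp
  ultimately obtain a where a: "a \<in> {a\<in>S. a = b \<or> (a, b) \<in> r}"
    and min: "\<And>c. (c, a) \<in> ?r \<Longrightarrow> c \<notin> {a\<in>S. a = b \<or> (a, b) \<in> r}"
    by (rule wfE_min) blast
  have "(c, a) \<notin> r" if "c \<in> S" for c
    using min[of c] a that assms(2) by (auto dest: transD)
  then show ?thesis using a by blast
qed

lemma self_map_permutes_subset:
  fixes h :: "'a \<Rightarrow> 'a"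
  assumes "finite A" "A \<noteq> {}" "h ` A \<subseteq> A"
  shows "\<exists>C\<subseteq>A. C \<noteq> {} \<and> h ` C = C"
proof -
  \<comment> \<open>A smallest nonempty invariant subset equals its image, since that image is invariant too.\<close>
  let ?inv = "\<lambda>C. C \<subseteq> A \<and> C \<noteq> {} \<and> h ` C \<subseteq> C"
  have "?inv A" using assms by simp
  then obtain C where C: "?inv C" and least: "\<And>C'. ?inv C' \<Longrightarrow> card C \<le> card C'"
    using ex_has_least_nat[of ?inv A card] by blast
  have "?inv (h ` C)" using C by blast
  then have "card C \<le> card (h ` C)" by (rule least)
  moreover have "finite C" using C assms(1) by (blast intro: finite_subset)
  ultimately have "h ` C = C" using C by (simp add: card_seteq)
  then show ?thesis using C by blast
qed

text \<open>
  The two selection maps, from the \<open>s\<close>-minimal elements to \<open>r\<close>-minimal ones below them in \<open>r\<close> and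
  vice versa, compose to a self-map of the set of \<open>r\<close>-minimal elements. On a subset that this
  composition permutes, both selections are injective.
\<close>
lemma alternating_descent_if_no_common_minimal:
  assumes "finite S" "S \<noteq> {}" "trans r" "irrefl r" "trans s" "irrefl s"
    and no_min: "\<forall>x\<in>S. \<exists>y\<in>S. (y, x) \<in> r \<union> s"
  shows "\<exists>C D f g. finite C \<and> finite D \<and> C \<noteq> {} \<and> C \<inter> D = {} \<and>
           inj_on f D \<and> f ` D \<subseteq> C \<and> (\<forall>d\<in>D. (f d, d) \<in> r) \<and>
           inj_on g C \<and> g ` C \<subseteq> D \<and> (\<forall>c\<in>C. (g c, c) \<in> s)"
proof -
  define A where "A = {a\<in>S. \<forall>c\<in>S. (c, a) \<notin> r}"
  define B where "B = {b\<in>S. \<forall>c\<in>S. (c, b) \<notin> s}"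
  have disj: "A \<inter> B = {}" using no_min by (fastforce simp: A_def B_def)
  have "\<exists>a\<in>A. a = b \<or> (a, b) \<in> r" if "b \<in> S" for b
    using minimal_below[OF assms(1,3,4) that] by (auto simp: A_def)
  note to_A = this
  have "\<exists>b\<in>B. b = a \<or> (b, a) \<in> s" if "a \<in> S" for a
    using minimal_below[OF assms(1,5,6) that] by (auto simp: B_def)
  note to_B = this
  have "\<forall>b\<in>B. \<exists>a\<in>A. (a, b) \<in> r" using to_A disj by (fastforce simp: B_def)
  then obtain f where f: "\<forall>b\<in>B. f b \<in> A \<and> (f b, b) \<in> r" by metis
  have "\<forall>a\<in>A. \<exists>b\<in>B. (b, a) \<in> s" using to_B disj by (fastforce simp: A_def)
  then obtain g where g: "\<forall>a\<in>A. g a \<in> B \<and> (g a, a) \<in> s" by metis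
  have "finite A" using assms(1) by (simp add: A_def)
  moreover have "A \<noteq> {}" using to_A assms(2) by blast
  moreover have "(f \<circ> g) ` A \<subseteq> A" using f g by auto
  ultimately have "\<exists>C\<subseteq>A. C \<noteq> {} \<and> (f \<circ> g) ` C = C" by (rule self_map_permutes_subset)
  then obtain C where C: "C \<subseteq> A" "C \<noteq> {}" "(f \<circ> g) ` C = C" by blast
  have finC: "finite C" using C(1) \<open>finite A\<close> by (rule finite_subset)
  have "inj_on (f \<circ> g) C" using finC C(3) by (simp add: eq_card_imp_inj_on)
  then have inj: "inj_on g C" "inj_on f (g ` C)"
    by (auto simp: inj_on_def)
  have "g ` C \<subseteq> B" using C(1) g by blast
  then have "C \<inter> g ` C = {}" "\<forall>d\<in>g ` C. (f d, d) \<in> r" using C(1) disj f by blast+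
  moreover have "f ` g ` C \<subseteq> C" using C(3) by (simp add: image_comp)
  moreover have "\<forall>c\<in>C. (g c, c) \<in> s" using C(1) g by blast
  ultimately show ?thesis using finC C(2) inj by blast
qed

lemma enumeration_if_minimal_elements:
  assumes "finite S" and "\<And>T. T \<subseteq> S \<Longrightarrow> T \<noteq> {} \<Longrightarrow> \<exists>x\<in>T. \<forall>y\<in>T. (y, x) \<notin> r"
  shows "\<exists>xs. set xs = S \<and> distinct xs \<and> sorted_wrt (\<lambda>x y. (y, x) \<notin> r) xs"
  using assms
proof (induction S rule: finite_psubset_induct)
  case (psubset S)
  show ?case
  proof (cases "S = {}")
    case False
    then obtain x where x: "x \<in> S" "\<forall>y\<in>S. (y, x) \<notin> r" using psubset.prems by blast
    have "\<exists>xs. set xs = S - {x} \<and> distinct xs \<and> sorted_wrt (\<lambda>x y. (y, x) \<notin> r) xs"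
      using x(1) psubset.prems by (intro psubset.IH) auto
    then obtain xs where "set xs = S - {x}" "distinct xs" "sorted_wrt (\<lambda>x y. (y, x) \<notin> r) xs"
      by blast
    then have "set (x # xs) = S \<and> distinct (x # xs) \<and> sorted_wrt (\<lambda>x y. (y, x) \<notin> r) (x # xs)"
      using x by auto
    then show ?thesis by blast
  qed simp
qed

section \<open>Labelled posets and their ideals\<close>

definition label_order :: "'a rel \<Rightarrow> ('n \<Rightarrow> 'a) \<Rightarrow> 'n rel" where
  "label_order r p = {(i, j). (p i, p j) \<in> r \<and> p i \<noteq> p j}"

lemma irrefl_label_order: "irrefl (label_order r p)"
  by (simp add: label_order_def irrefl_def)

lemma trans_label_order:
  assumes "partial_order_on P r"
  shows "trans (label_order r p)"
proof -
  have "trans r" "antisym r"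
    using assms by (auto simp: partial_order_on_def preorder_on_def)
  then show ?thesis
    by (intro transI) (auto simp: label_order_def dest: transD antisymD)
qed

lemma linear_extension_if_sorted_wrt:
  assumes "set xs = UNIV" "distinct xs" "sorted_wrt (\<lambda>x y. (y, x) \<notin> R) xs" "label_order r p \<subseteq> R"
  shows "is_linear_extension r p xs"
  unfolding is_linear_extension_def
proof (intro conjI allI impI)
  show "xs \<in> permutations_of_set UNIV" using assms by (simp add: permutations_of_set_def)
  fix a b
  assume ab: "a < length xs" "b < length xs"
    and le: "(p (xs ! a), p (xs ! b)) \<in> r \<and> p (xs ! a) \<noteq> p (xs ! b)"
  then have "(xs ! a, xs ! b) \<in> R" using assms(4) by (auto simp: label_order_def)
  then have "\<not> b < a" using sorted_wrt_nth_less[OF assms(3), of b a] ab by blast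
  moreover have "a \<noteq> b" using le by auto
  ultimately show "a < b" by simp
qed

lemma ideal_closed_under_label_order:
  assumes "I \<in> poset_ideals P r" "bij_betw p UNIV P" "(i, j) \<in> label_order r p" "p j \<in> I"
  shows "p i \<in> I"
  using assms by (auto simp: poset_ideals_def label_order_def bij_betw_def)

lemma initial_segment_ideal:
  assumes "is_linear_extension r p \<sigma>" "bij_betw p UNIV P"
  shows "p ` set (take k \<sigma>) \<in> poset_ideals P r"
  unfolding poset_ideals_def
proof (intro CollectI conjI ballI impI)
  show "p ` set (take k \<sigma>) \<subseteq> P" using assms(2) by (auto simp: bij_betw_def)
  fix x y
  assume x: "x \<in> p ` set (take k \<sigma>)" and y: "y \<in> P" and yx: "(y, x) \<in> r"
  obtain a where a: "a < k" "a < length \<sigma>" "x = p (\<sigma> ! a)"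
    using x by (auto simp: in_set_conv_nth)
  have "set \<sigma> = UNIV" using assms(1) by (simp add: is_linear_extension_def permutations_of_set_def)
  then have "y \<in> p ` set \<sigma>" using y assms(2) by (simp add: bij_betw_def)
  then obtain b where b: "b < length \<sigma>" "y = p (\<sigma> ! b)"
    by (auto simp: in_set_conv_nth)
  show "y \<in> p ` set (take k \<sigma>)"
  proof (cases "y = x")
    case False
    then have "b < a" using assms(1) a b yx by (auto simp: is_linear_extension_def)
    then have "\<sigma> ! b \<in> set (take k \<sigma>)" using a b by (auto simp: in_set_conv_nth intro!: exI[of _ b])
    then show ?thesis using b by blast
  qed (use x in simp)
qed

lemma rho_image:
  assumes "inj p"
  shows "rho p (p ` A) = (\<Sum>i\<in>A. axis i 1)"
  using assms by (simp add: rho_def inj_image_mem_iff)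

lemma inner_rho:
  fixes v :: "real ^ 'n::finite"
  shows "v \<bullet> rho p I = (\<Sum>i | p i \<in> I. v $ i)"
  by (simp add: rho_def inner_sum_right inner_axis)

lemma rho_empty: "rho p {} = 0"
  by (simp add: rho_def)

text \<open>
  Nonemptiness of the ideal can be dropped because the empty ideal contributes the origin. The
  initial segment preceding the first label is of this kind.
\<close>
lemma ideal_in_twinned_Omega:
  assumes "I \<in> poset_ideals P r"
  shows "rho p I \<in> twinned_Omega P r p Q s q"
  using assms by (cases "I = {}") (auto simp: twinned_Omega_def rho_empty)

lemma minus_ideal_in_twinned_Omega:
  assumes "J \<in> poset_ideals Q s"
  shows "- rho q J \<in> twinned_Omega P r p Q s q"
  using assms by (cases "J = {}") (auto simp: twinned_Omega_def rho_empty)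

lemma half_diff_in_twinned_order_polytope:
  assumes "I \<in> poset_ideals P r" "J \<in> poset_ideals Q s"
  shows "(1/2) *\<^sub>R (rho p I - rho q J) \<in> twinned_order_polytope P r p Q s q"
proof -
  have "(1/2) *\<^sub>R rho p I + (1/2) *\<^sub>R (- rho q J) \<in> twinned_order_polytope P r p Q s q"
    unfolding twinned_order_polytope_def
    using ideal_in_twinned_Omega[OF assms(1)] minus_ideal_in_twinned_Omega[OF assms(2)]
    by (intro convexD convex_convex_hull hull_inc) auto
  then show ?thesis by (simp add: algebra_simps)
qed

section \<open>Interior points of convex sets\<close>

lemma zero_in_interior_if_half_axes:
  fixes S :: "(real ^ 'n::finite) set"
  assumes "convex S"
    and pos: "\<And>i. (1/2) *\<^sub>R axis i 1 \<in> S" and neg: "\<And>i. - ((1/2) *\<^sub>R axis i 1) \<in> S"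
  shows "0 \<in> interior S"
proof -
  let ?d = "real CARD('n)"
  have d: "?d > 0" by simp
  have "x \<in> S" if "x \<in> ball 0 (1 / (2 * ?d))" for x
  proof -
    \<comment> \<open>Write \<open>x\<close> as the average of the vectors \<open>d x\<^sub>i e\<^sub>i\<close>; each lies between \<open>- e\<^sub>i / 2\<close> and \<open>e\<^sub>i / 2\<close>.\<close>
    have "(?d * x $ i) *\<^sub>R axis i 1 \<in> S" for i
    proof -
      define t where "t = ?d * x $ i"
      have "\<bar>x $ i\<bar> \<le> norm x" by (rule component_le_norm_cart)
      also have "\<dots> < 1 / (2 * ?d)" using that by simp
      finally have "?d * \<bar>x $ i\<bar> < 1/2" using d by (simp add: field_simps)
      then have "\<bar>t\<bar> < 1/2" by (simp add: t_def abs_mult)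
      then have "(1/2 + t) *\<^sub>R ((1/2) *\<^sub>R axis i 1) + (1/2 - t) *\<^sub>R (- ((1/2) *\<^sub>R axis i 1)) \<in> S"
        by (intro convexD[OF assms(1) pos neg]) auto
      moreover have "(1/2 + t) *\<^sub>R ((1/2) *\<^sub>R axis i 1) + (1/2 - t) *\<^sub>R (- ((1/2) *\<^sub>R axis i 1))
          = t *\<^sub>R (axis i 1 :: real ^ 'n)"
        by (simp add: vec_eq_iff field_simps)
      ultimately show ?thesis by (simp add: t_def)
    qed
    then have "(\<Sum>i\<in>UNIV. (1 / ?d) *\<^sub>R ((?d * x $ i) *\<^sub>R axis i 1)) \<in> S"
      by (intro convex_sum assms(1)) auto
    moreover have "(\<Sum>i\<in>UNIV. (1 / ?d) *\<^sub>R ((?d * x $ i) *\<^sub>R axis i 1)) = x"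
      by (simp add: vec_eq_iff axis_def if_distrib cong: if_cong)
    ultimately show ?thesis by simp
  qed
  then have "ball 0 (1 / (2 * ?d)) \<subseteq> S" by blast
  moreover have "0 \<in> ball 0 (1 / (2 * ?d))" by simp
  ultimately show ?thesis by (meson interiorI open_ball)
qed

lemma zero_functional_if_nonneg_on_hull:
  fixes v :: "'a::real_inner"
  assumes "0 \<in> interior (convex hull S)" and "\<And>x. x \<in> S \<Longrightarrow> 0 \<le> v \<bullet> x"
  shows "v = 0"
proof (rule ccontr)
  assume "v \<noteq> 0"
  have "convex {x. 0 \<le> v \<bullet> x}"
    using convex_halfspace_ge[of 0 v] by simp
  then have "convex hull S \<subseteq> {x. 0 \<le> v \<bullet> x}" using assms(2) by (intro hull_minimal) auto
  then obtain e where e: "e > 0" "cball 0 e \<subseteq> {x. 0 \<le> v \<bullet> x}"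
    using assms(1) by (meson mem_interior_cball subset_trans)
  \<comment> \<open>The point of the ball at which the functional is most negative.\<close>
  have "- (e / norm v) *\<^sub>R v \<in> cball 0 e" using \<open>v \<noteq> 0\<close> e(1) by simp
  then have "- (e / norm v) *\<^sub>R v \<in> {x. 0 \<le> v \<bullet> x}" using e(2) by blast
  then have "0 \<le> - (e / norm v) * (v \<bullet> v)" by simp
  moreover have "(e / norm v) * (v \<bullet> v) > 0" using \<open>v \<noteq> 0\<close> e(1) by simp
  ultimately show False by linarith
qed

section \<open>Interior origin and common linear extensions\<close>

lemma zero_in_interior_if_common_linear_extension:
  fixes p :: "'n::finite \<Rightarrow> 'a" and q :: "'n \<Rightarrow> 'b"
  assumes p: "bij_betw p UNIV P" and q: "bij_betw q UNIV Q"
    and ext: "is_linear_extension r p \<sigma>" "is_linear_extension s q \<sigma>"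
  shows "0 \<in> interior (twinned_order_polytope P r p Q s q)"
proof (rule zero_in_interior_if_half_axes)
  show "convex (twinned_order_polytope P r p Q s q)"
    by (simp add: twinned_order_polytope_def)
  fix i
  define seg where "seg k = (\<Sum>j\<in>set (take k \<sigma>). axis j 1 :: real ^ 'n)" for k
  have seg: "rho p (p ` set (take k \<sigma>)) = seg k" "rho q (q ` set (take k \<sigma>)) = seg k" for k
    using p q by (simp_all add: rho_image bij_betw_def seg_def)
  have \<sigma>: "set \<sigma> = UNIV" "distinct \<sigma>"
    using ext(1) by (simp_all add: is_linear_extension_def permutations_of_set_def)
  then obtain k where k: "k < length \<sigma>" "\<sigma> ! k = i" by (metis UNIV_I in_set_conv_nth)
  then have "set (take (Suc k) \<sigma>) = insert i (set (take k \<sigma>))"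
    by (simp add: take_Suc_conv_app_nth)
  moreover have "i \<notin> set (take k \<sigma>)"
    using k \<sigma>(2) by (auto simp: in_set_conv_nth nth_eq_iff_index_eq)
  ultimately have step: "seg (Suc k) - seg k = axis i 1"
    by (simp add: seg_def)
  have half: "(1/2) *\<^sub>R (seg m - seg n) \<in> twinned_order_polytope P r p Q s q" for m n
    using half_diff_in_twinned_order_polytope[where p = p and q = q,
        OF initial_segment_ideal[OF ext(1) p, of m] initial_segment_ideal[OF ext(2) q, of n]]
    by (simp add: seg)
  show "(1/2) *\<^sub>R axis i 1 \<in> twinned_order_polytope P r p Q s q"
    using half[of "Suc k" k] by (simp add: step)
  have "- ((1/2) *\<^sub>R axis i 1) = (1/2) *\<^sub>R (seg k - seg (Suc k))"
    by (simp add: step[symmetric] algebra_simps)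
  then show "- ((1/2) *\<^sub>R axis i 1) \<in> twinned_order_polytope P r p Q s q"
    using half[of k "Suc k"] by simp
qed

text \<open>
  An ideal containing \<open>d\<close> also contains \<open>f d\<close>, so \<open>f\<close> injects the part of \<open>D\<close> inside the ideal into
  the part of \<open>C\<close> inside it.
\<close>
lemma ideal_meets_lower_set_more:
  assumes I: "I \<in> poset_ideals P r" "bij_betw p UNIV P"
    and "finite C" "inj_on f D" "f ` D \<subseteq> C" and desc: "\<forall>d\<in>D. (f d, d) \<in> label_order r p"
  shows "card (D \<inter> {i. p i \<in> I}) \<le> card (C \<inter> {i. p i \<in> I})"
proof (rule card_inj_on_le)
  show "inj_on f (D \<inter> {i. p i \<in> I})" using assms(4) by (rule inj_on_subset) blast
  show "f ` (D \<inter> {i. p i \<in> I}) \<subseteq> C \<inter> {i. p i \<in> I}"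
    using assms(5) desc ideal_closed_under_label_order[OF I] by blast
  show "finite (C \<inter> {i. p i \<in> I})" using assms(3) by simp
qed

lemma common_minimal_if_zero_in_interior:
  fixes p :: "'n::finite \<Rightarrow> 'a" and q :: "'n \<Rightarrow> 'b"
  assumes P: "partial_order_on P r" and p: "bij_betw p UNIV P"
    and Q: "partial_order_on Q s" and q: "bij_betw q UNIV Q"
    and int: "0 \<in> interior (twinned_order_polytope P r p Q s q)" and "S \<noteq> {}"
  shows "\<exists>x\<in>S. \<forall>y\<in>S. (y, x) \<notin> label_order r p \<union> label_order s q"
proof (rule ccontr)
  assume "\<not> ?thesis"
  then have "\<forall>x\<in>S. \<exists>y\<in>S. (y, x) \<in> label_order r p \<union> label_order s q" by blast
  from alternating_descent_if_no_common_minimal[OF finite \<open>S \<noteq> {}\<close> trans_label_order[OF P]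
      irrefl_label_order trans_label_order[OF Q] irrefl_label_order this]
  obtain C D f g where "finite C" "finite D" and CD: "C \<noteq> {}" "C \<inter> D = {}"
    and f: "inj_on f D" "f ` D \<subseteq> C" "\<forall>d\<in>D. (f d, d) \<in> label_order r p"
    and g: "inj_on g C" "g ` C \<subseteq> D" "\<forall>c\<in>C. (g c, c) \<in> label_order s q"
    by blast
  define v :: "real ^ 'n" where "v = (\<chi> i. of_bool (i \<in> C) - of_bool (i \<in> D))"
  have count: "(\<Sum>i\<in>U. v $ i) = real (card (C \<inter> U)) - real (card (D \<inter> U))" for U
    by (simp add: v_def sum_subtractf of_bool_def sum.If_cases Int_commute)
  have "0 \<le> v \<bullet> x" if "x \<in> twinned_Omega P r p Q s q" for x
  proof -
    consider I where "x = rho p I" "I \<in> poset_ideals P r"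
      | J where "x = - rho q J" "J \<in> poset_ideals Q s" | "x = 0"
      using \<open>x \<in> _\<close> by (auto simp: twinned_Omega_def)
    then show ?thesis
    proof cases
      case 1
      then show ?thesis
        using ideal_meets_lower_set_more[OF _ p \<open>finite C\<close> f] by (simp add: inner_rho count)
    next
      case 2
      then show ?thesis
        using ideal_meets_lower_set_more[OF _ q \<open>finite D\<close> g] by (simp add: inner_rho count)
    qed simp
  qed
  then have "v = 0"
    using int zero_functional_if_nonneg_on_hull unfolding twinned_order_polytope_def by blast
  moreover obtain c where "c \<in> C" using CD(1) by blast
  then have "v $ c = 1" using CD(2) by (auto simp: v_def)
  ultimately show False by simp
qed

theorem lemma1p1:
  fixes P :: "'a set" and leP :: "'a rel" and p :: "'n::finite \<Rightarrow> 'a"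
    and Q :: "'b set" and leQ :: "'b rel" and q :: "'n \<Rightarrow> 'b"
  assumes "partial_order_on P leP" and "bij_betw p UNIV P"
    and "partial_order_on Q leQ" and "bij_betw q UNIV Q"
  shows "0 \<in> interior (twinned_order_polytope P leP p Q leQ q) \<longleftrightarrow>
         (\<exists>\<sigma>. is_linear_extension leP p \<sigma> \<and> is_linear_extension leQ q \<sigma>)"
proof
  assume int: "0 \<in> interior (twinned_order_polytope P leP p Q leQ q)"
  let ?R = "label_order leP p \<union> label_order leQ q"
  have "\<exists>\<sigma>. set \<sigma> = UNIV \<and> distinct \<sigma> \<and> sorted_wrt (\<lambda>x y. (y, x) \<notin> ?R) \<sigma>"
    using common_minimal_if_zero_in_interior[OF assms int]
    by (intro enumeration_if_minimal_elements) auto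
  then obtain \<sigma> where \<sigma>: "set \<sigma> = UNIV" "distinct \<sigma>" "sorted_wrt (\<lambda>x y. (y, x) \<notin> ?R) \<sigma>"
    by blast
  show "\<exists>\<sigma>. is_linear_extension leP p \<sigma> \<and> is_linear_extension leQ q \<sigma>"
    using linear_extension_if_sorted_wrt[OF \<sigma> Un_upper1]
      linear_extension_if_sorted_wrt[OF \<sigma> Un_upper2] by blast
next
  assume "\<exists>\<sigma>. is_linear_extension leP p \<sigma> \<and> is_linear_extension leQ q \<sigma>"
  then show "0 \<in> interior (twinned_order_polytope P leP p Q leQ q)"
    using zero_in_interior_if_common_linear_extension[OF assms(2,4)] by blast
qed

end
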